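(* Let $q \geq 1$ be a real number and let $\{z_n\}_{n \geq 0}$ be a sequence of complex numbers in $\ell^q$, that is, $\sum_{n=0}^{\infty} |z_n|^q < \infty$. For positive integers $p$, let $M_p = \sum_{n=0}^{\infty} z_n^p$. Then $$\limsup_{p \to \infty} |M_p|^{1/p} = \max_{n \geq 0} |z_n|.$$
   Context: For a sequence $\{z_n\}_{n\ge 0}$ of complex numbers and a positive integer $p$, the $p$-th moment is $M_p = \sum_{n=0}^{\infty} z_n^p$. The limsup is taken over positive integers $p$. For a sequence in $\ell^q$ the series defining $M_p$ converges absolutely for every integer $p \geq q$; the finitely many values $p < q$, for which the series need not converge, are irrelevant to the limsup. *)

theory Defs
  imports "HOL-Analysis.Analysis"
begin

(* For z in l^q the series converges absolutely whenever p >= q. For the finitely many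
   other p it may diverge, and then the value is unspecified; this does not affect a
   limsup over p. *)
definition moment :: "(nat \<Rightarrow> complex) \<Rightarrow> nat \<Rightarrow> complex" where
  "moment z p = (\<Sum>n. z n ^ p)"

end

theory Submission
  imports Defs
begin

text \<open>
  Let \<open>R\<close> be the maximum of the moduli. The upper bound holds because
  \<open>\<bar>M\<^sub>p\<bar> \<le> R\<^sup>p\<^sup>-\<^sup>q \<Sum>\<bar>z\<^sub>n\<bar>\<^sup>q\<close> for \<open>p \<ge> q\<close>. For the lower bound, fix \<open>m\<close> such that
  \<open>\<Sum>\<^sub>n\<^sub>\<ge>\<^sub>m \<bar>z\<^sub>n\<bar>\<^sup>q \<le> R\<^sup>q / 4\<close>. Dirichlet's simultaneous approximation theorem
  gives arbitrarily large \<open>p\<close> for which all the powers \<open>z\<^sub>n\<^sup>p\<close> with \<open>n < m\<close> lie within an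
  angle \<open>\<pi> / 3\<close> of the positive real axis, so nothing cancels in the head of the series:
  its real part is at least \<open>R\<^sup>p / 2\<close>, while the tail is at most \<open>R\<^sup>p / 4\<close>.
\<close>

text \<open>The terms of a convergent series tend to 0, so all but finitely many moduli lie below
  that of one fixed nonzero entry. The largest modulus of the finite head is therefore a global
  maximum.\<close>

lemma summable_powr_norm_attains_max:
  fixes z :: "nat \<Rightarrow> 'a :: real_normed_vector"
  assumes "q > 0" and summ: "summable (\<lambda>n. norm (z n) powr q)"
  obtains N where "\<And>n. norm (z n) \<le> norm (z N)"
proof (cases "\<forall>n. z n = 0")
  case True
  then show ?thesis using that[of 0] by simp
next
  case False
  then obtain k where "z k \<noteq> 0" by blast
  then have "norm (z k) powr q > 0" by simp
  with summable_LIMSEQ_zero[OF summ]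
  have "eventually (\<lambda>n. norm (z n) powr q < norm (z k) powr q) sequentially"
    by (rule order_tendstoD)
  then obtain m where m: "\<And>n. n \<ge> m \<Longrightarrow> norm (z n) powr q < norm (z k) powr q"
    by (auto simp: eventually_sequentially)
  have "k < m"
    using m[of k] by (meson less_irrefl not_le)
  define A where "A = (\<lambda>n. norm (z n)) ` {..<m}"
  have A: "finite A" "A \<noteq> {}"
    using \<open>k < m\<close> by (auto simp: A_def)
  then obtain N where N: "norm (z N) = Max A"
    using Max_in[OF A] by (metis A_def imageE)
  have head: "norm (z n) \<le> norm (z N)" if "n < m" for n
    unfolding N using A that by (intro Max_ge) (auto simp: A_def)
  have "norm (z n) \<le> norm (z N)" for n
  proof (cases "n < m")
    case True
    then show ?thesis by (rule head)
  next
    case False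
    then have "norm (z n) < norm (z k)"
      using m[of n] \<open>q > 0\<close>
        powr_mono2[of q "norm (z k)" "norm (z n)"]
      by (metis False not_le less_imp_le norm_ge_zero)
    with head[OF \<open>k < m\<close>] show ?thesis by simp
  qed
  with that show ?thesis by blast
qed

lemma power_le_powr_diff_mult_powr:
  fixes x R q :: real
  assumes "0 \<le> x" "x \<le> R" "q \<le> real p" "p > 0"
  shows "x ^ p \<le> R powr (real p - q) * x powr q"
proof (cases "x = 0")
  case False
  then have "x ^ p = x powr (real p - q) * x powr q"
    using assms by (simp add: powr_realpow flip: powr_add)
  also have "\<dots> \<le> R powr (real p - q) * x powr q"
    using assms by (intro mult_right_mono powr_mono2) auto
  finally show ?thesis .
\<comment> \<open>This case rests on \<open>p > 0\<close>: \<open>0 ^ 0\<close> is 1, whereas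
  \<open>0 powr q\<close> is 0 for every \<open>q\<close>.\<close>
qed (use assms in \<open>simp add: power_0_left\<close>)

text \<open>The offset \<open>m\<close> lets one estimate serve both bounds: \<open>m = 0\<close>
  controls the whole moment from above, a large \<open>m\<close> makes the tail small.\<close>

lemma powr_summable_imp_power_summable:
  fixes z :: "nat \<Rightarrow> complex"
  assumes "summable (\<lambda>n. norm (z n) powr q)" "\<And>n. norm (z n) \<le> R" "q \<le> real p" "p > 0"
  shows "summable (\<lambda>n. norm (z n ^ p))"
    and "(\<Sum>n. norm (z (n + m) ^ p)) \<le> R powr (real p - q) * (\<Sum>n. norm (z (n + m)) powr q)"
proof -
  have le: "norm (z n ^ p) \<le> R powr (real p - q) * norm (z n) powr q" for n
    using power_le_powr_diff_mult_powr[OF norm_ge_zero assms(2-4)] by (simp add: norm_power)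
  show summ: "summable (\<lambda>n. norm (z n ^ p))"
    by (rule summable_comparison_test_ev[OF _ summable_mult[OF assms(1)]])
       (use le in \<open>auto intro!: always_eventually\<close>)
  have "summable (\<lambda>n. norm (z (n + m)) powr q)"
    using assms(1) by (subst summable_iff_shift)
  moreover have "summable (\<lambda>n. norm (z (n + m) ^ p))"
    using summ by (subst summable_iff_shift)
  ultimately show "(\<Sum>n. norm (z (n + m) ^ p)) \<le>
      R powr (real p - q) * (\<Sum>n. norm (z (n + m)) powr q)"
    by (subst suminf_mult[symmetric]) (auto intro!: suminf_le le summable_mult)
qed

lemma frequently_Re_power_ge:
  fixes z :: "nat \<Rightarrow> complex"
  shows "frequently (\<lambda>p. \<forall>i<m. Re (z i ^ p) \<ge> norm (z i) ^ p / 2) sequentially"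
  unfolding frequently_sequentially
proof
  fix K :: nat
  \<comment> \<open>\<open>Arg (z i) / (2 * pi)\<close> measures the argument in full turns.
    Dirichlet's theorem may return a small denominator \<open>d\<close>; building
    \<open>Suc K\<close> into the angles makes the exponent \<open>d * Suc K\<close> exceed
    \<open>K\<close>.\<close>
  define \<theta> where "\<theta> i = real (Suc K) * (Arg (z i) / (2 * pi))" for i
  \<comment> \<open>One sixth of a turn is the angle \<open>pi / 3\<close>, whose cosine is
    1/2.\<close>
  obtain d a where d: "0 < d"
    and a: "\<And>i. i < m \<Longrightarrow> \<bar>of_int d * \<theta> i - of_int (a i)\<bar> < 1 / real 6"
    using Dirichlet_approx_simult[of 6 m \<theta>] zero_less_numeral by metis
  define p where "p = nat d * Suc K"
  have "p \<ge> K"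
    using d by (cases "nat d") (auto simp: p_def)
  moreover have "Re (z i ^ p) \<ge> norm (z i) ^ p / 2" if "i < m" for i
  proof -
    define x where "x = of_int d * \<theta> i - of_int (a i)"
    have eq: "real p * Arg (z i) = 2 * pi * x + 2 * pi * of_int (a i)"
      using d by (simp add: x_def \<theta>_def p_def field_simps)
    have "cos (real p * Arg (z i)) = cos (2 * pi * x)"
      unfolding eq by (simp add: cos_add sin_int_2pin cos_int_2pin)
    also have "\<dots> = cos \<bar>2 * pi * x\<bar>"
      by simp
    also have "cos \<bar>2 * pi * x\<bar> \<ge> cos (pi / 3)"
    proof (rule cos_monotone_0_pi_le)
      have "\<bar>x\<bar> \<le> 1 / 6"
        using a[OF that] by (simp add: x_def)
      then have "2 * pi * \<bar>x\<bar> \<le> 2 * pi * (1 / 6)"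
        by (rule mult_left_mono) simp
      then show "\<bar>2 * pi * x\<bar> \<le> pi / 3"
        by (simp add: abs_mult)
    qed auto
    finally have cos: "cos (real p * Arg (z i)) \<ge> 1 / 2"
      by (simp add: cos_60)
    have "z i ^ p = rcis (norm (z i) ^ p) (real p * Arg (z i))"
      by (metis DeMoivre2 rcis_cmod_Arg)
    then have "Re (z i ^ p) = norm (z i) ^ p * cos (real p * Arg (z i))"
      by simp
    with mult_left_mono[OF cos, of "norm (z i) ^ p"] show ?thesis
      by simp
  qed
  ultimately show "\<exists>p\<ge>K. \<forall>i<m. Re (z i ^ p) \<ge> norm (z i) ^ p / 2"
    by blast
qed

lemma frequently_norm_moment_ge:
  fixes z :: "nat \<Rightarrow> complex"
  assumes summ: "summable (\<lambda>n. norm (z n) powr q)"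
    and max: "\<And>n. norm (z n) \<le> norm (z N)" and "z N \<noteq> 0"
  shows "frequently (\<lambda>p. norm (moment z p) \<ge> norm (z N) ^ p / 4) sequentially"
proof -
  define R where "R = norm (z N)"
  have "R > 0" using \<open>z N \<noteq> 0\<close> by (simp add: R_def)
  then have "R powr q / 4 > 0" by simp
  from suminf_exist_split[OF this summ] obtain m0
    where m0: "\<And>n. n \<ge> m0 \<Longrightarrow> norm (\<Sum>i. norm (z (i + n)) powr q) < R powr q / 4"
    by blast
  \<comment> \<open>Taking \<open>m\<close> beyond \<open>N\<close> places a term of maximal modulus
    in the head.\<close>
  define m where "m = max m0 (Suc N)"
  have "N < m" by (simp add: m_def)
  have tail: "(\<Sum>i. norm (z (i + m)) powr q) \<le> R powr q / 4"
    using m0[of m] by (simp add: m_def)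
  have ge: "norm (moment z p) \<ge> R ^ p / 4"
    if p: "q \<le> real p" "p > 0" and Re: "\<forall>i<m. Re (z i ^ p) \<ge> norm (z i) ^ p / 2" for p
  proof -
    have summ_p: "summable (\<lambda>n. norm (z n ^ p))"
      by (rule powr_summable_imp_power_summable(1)[OF summ max p])
    then have split: "moment z p = (\<Sum>n. z (n + m) ^ p) + (\<Sum>n<m. z n ^ p)"
      unfolding moment_def by (rule suminf_split_initial_segment[OF summable_norm_cancel])
    have "summable (\<lambda>n. norm (z (n + m) ^ p))"
      using summ_p by (subst summable_iff_shift)
    then have "norm (\<Sum>n. z (n + m) ^ p) \<le> (\<Sum>n. norm (z (n + m) ^ p))"
      by (rule summable_norm)
    also have "\<dots> \<le> R powr (real p - q) * (\<Sum>n. norm (z (n + m)) powr q)"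
      unfolding R_def by (rule powr_summable_imp_power_summable(2)[OF summ max p])
    also have "\<dots> \<le> R powr (real p - q) * (R powr q / 4)"
      by (intro mult_left_mono tail) auto
    also have "\<dots> = R ^ p / 4"
      using \<open>R > 0\<close> by (simp add: powr_realpow flip: powr_add)
    finally have "norm (\<Sum>n. z (n + m) ^ p) \<le> R ^ p / 4" .
    then have Re_tail: "Re (\<Sum>n. z (n + m) ^ p) \<ge> - (R ^ p / 4)"
      using abs_Re_le_cmod[of "\<Sum>n. z (n + m) ^ p"] by linarith
    have "R ^ p / 2 \<le> Re (z N ^ p)"
      using Re \<open>N < m\<close> by (simp add: R_def)
    \<comment> \<open>For such \<open>p\<close> every head term has nonnegative real part, so the
      head dominates its \<open>N\<close>-th term alone.\<close>
    also have "\<dots> \<le> (\<Sum>n<m. Re (z n ^ p))"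
    proof (rule member_le_sum)
      show "0 \<le> Re (z n ^ p)" if "n \<in> {..<m} - {N}" for n
        using Re that by (auto intro: order_trans[of 0 "norm (z n) ^ p / 2"])
    qed (use \<open>N < m\<close> in auto)
    finally have "Re (moment z p) \<ge> R ^ p / 4"
      using Re_tail by (simp add: split Re_sum)
    then show ?thesis
      using complex_Re_le_cmod[of "moment z p"] by linarith
  qed
  \<comment> \<open>The side conditions on \<open>p\<close> hold from some point on, so they can be
    imposed on the infinitely many exponents given by Dirichlet's theorem.\<close>
  have "eventually (\<lambda>p. q \<le> real p \<and> p > 0) sequentially"
    using eventually_ge_at_top[of "max 1 (nat \<lceil>q\<rceil>)"] by eventually_elim linarith
  with frequently_Re_power_ge[of m z]
  have "frequently (\<lambda>p. (q \<le> real p \<and> p > 0) \<and>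
      (\<forall>i<m. Re (z i ^ p) \<ge> norm (z i) ^ p / 2)) sequentially"
    by (rule frequently_eventually_conj)
  then show ?thesis
    by (rule frequently_elim1) (use ge in \<open>auto simp: R_def\<close>)
qed

text \<open>The factor next to \<open>R ^ p\<close> is independent of \<open>p\<close>, so it
  disappears in the limit of \<open>p\<close>-th roots.\<close>

lemma eventually_norm_moment_le:
  fixes z :: "nat \<Rightarrow> complex"
  assumes summ: "summable (\<lambda>n. norm (z n) powr q)"
    and max: "\<And>n. norm (z n) \<le> R" and "R > 0"
  shows "eventually (\<lambda>p. norm (moment z p) \<le>
    R ^ p * ((\<Sum>n. norm (z n) powr q) / R powr q)) sequentially"
  using eventually_ge_at_top[of "max 1 (nat \<lceil>q\<rceil>)"]
proof eventually_elim
  case (elim p)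
  then have p: "q \<le> real p" "p > 0" by linarith+
  have "norm (moment z p) \<le> (\<Sum>n. norm (z n ^ p))"
    unfolding moment_def
    by (rule summable_norm[OF powr_summable_imp_power_summable(1)[OF summ max p]])
  also have "\<dots> \<le> R powr (real p - q) * (\<Sum>n. norm (z n) powr q)"
    using powr_summable_imp_power_summable(2)[OF summ max p, of 0] by simp
  finally show ?case
    using \<open>R > 0\<close> by (simp add: powr_diff powr_realpow)
qed

text \<open>The \<open>p\<close>-th roots of a positive constant tend to 1. This is used with
  \<open>c = C\<close> for the upper bound and with \<open>c = 1 / 4\<close> for the lower
  one.\<close>

lemma tendsto_root_power_mult:
  assumes "R \<ge> 0" "c > 0"
  shows "(\<lambda>p. root p (R ^ p * c)) \<longlonglongrightarrow> R"
proof -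
  have "(\<lambda>p. R * root p c) \<longlonglongrightarrow> R * 1"
    by (intro tendsto_intros LIMSEQ_root_const assms)
  moreover have "eventually (\<lambda>p. R * root p c = root p (R ^ p * c)) sequentially"
    using eventually_gt_at_top[of 0]
    by eventually_elim (use assms in \<open>simp add: real_root_mult real_root_power_cancel\<close>)
  ultimately show ?thesis
    using Lim_transform_eventually by fastforce
qed

theorem theorem2:
  fixes q :: real and z :: "nat \<Rightarrow> complex"
  assumes "q \<ge> 1"
    and "summable (\<lambda>n. norm (z n) powr q)"
  shows "\<exists>N. (\<forall>n. norm (z n) \<le> norm (z N)) \<and>
    limsup (\<lambda>p::nat. ereal (root p (norm (moment z p)))) = ereal (norm (z N))"
proof -
  note summ = assms(2)
  obtain N where max: "\<And>n. norm (z n) \<le> norm (z N)"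
    using summable_powr_norm_attains_max[OF _ summ] assms(1) by auto
  define R where "R = norm (z N)"
  let ?L = "limsup (\<lambda>p. ereal (root p (norm (moment z p))))"
  have "?L = ereal R"
  proof (cases "z N = 0")
    case True
    then have "z n = 0" for n using max[of n] by simp
    \<comment> \<open>At \<open>p = 0\<close> every term \<open>0 ^ 0\<close> is 1 and the series
      diverges, but \<open>root 0\<close> is 0 by convention.\<close>
    then have "root p (norm (moment z p)) = 0" for p
      by (cases "p = 0") (simp_all add: moment_def power_0_left)
    then show ?thesis
      using True by (simp add: R_def Limsup_const zero_ereal_def)
  next
    case False
    then have "R > 0" by (simp add: R_def)
    define C where "C = (\<Sum>n. norm (z n) powr q) / R powr q"
    have "(\<Sum>n. norm (z n) powr q) > 0"
      using False by (intro suminf_pos2[OF summ, of N]) auto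
    then have "C > 0" using \<open>R > 0\<close> by (simp add: C_def)
    show ?thesis
    proof (rule antisym)
      have "eventually (\<lambda>p. norm (moment z p) \<le> R ^ p * C) sequentially"
        using eventually_norm_moment_le[OF summ, of R] max \<open>R > 0\<close> by (simp add: R_def C_def)
      then have "eventually (\<lambda>p. ereal (root p (norm (moment z p))) \<le>
          ereal (root p (R ^ p * C))) sequentially"
        using eventually_gt_at_top[of 0] by eventually_elim simp
      then have "?L \<le> limsup (\<lambda>p. ereal (root p (R ^ p * C)))"
        by (rule Limsup_mono)
      also have "\<dots> = ereal R"
        using tendsto_root_power_mult[of R C] \<open>R > 0\<close> \<open>C > 0\<close> by (intro lim_imp_Limsup) auto
      finally show "?L \<le> ereal R" .
    next
      show "ereal R \<le> ?L"
      proof (rule ccontr)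
        assume "\<not> ereal R \<le> ?L"
        \<comment> \<open>A real \<open>c\<close> strictly between the limsup and \<open>R\<close>
          eventually separates the roots of the moments from the roots of \<open>R ^ p / 4\<close>,
          which tend to \<open>R\<close>. This contradicts the lower bound that holds for infinitely
          many \<open>p\<close>.\<close>
        then obtain c where c: "?L < ereal c" "c < R"
          using ereal_dense2[of ?L "ereal R"] by (auto simp: not_le)
        have "eventually (\<lambda>p. root p (norm (moment z p)) < c) sequentially"
          using Limsup_lessD[OF c(1)] by simp
        moreover have "eventually (\<lambda>p. c < root p (R ^ p * (1 / 4))) sequentially"
          using \<open>R > 0\<close> c(2) by (intro order_tendstoD(1)[OF tendsto_root_power_mult]) auto
        ultimately have "eventually (\<lambda>p. norm (moment z p) < R ^ p / 4) sequentially"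
          using eventually_gt_at_top[of 0]
        proof eventually_elim
          case (elim p)
          then have "root p (norm (moment z p)) < root p (R ^ p * (1 / 4))"
            by (blast intro: less_trans)
          with \<open>p > 0\<close> have "norm (moment z p) < R ^ p * (1 / 4)"
            by (subst (asm) real_root_less_iff)
          then show ?case by simp
        qed
        moreover have "frequently (\<lambda>p. norm (moment z p) \<ge> R ^ p / 4) sequentially"
          unfolding R_def by (rule frequently_norm_moment_ge[OF summ max False])
        ultimately show False
          by (auto simp: frequently_def not_le)
      qed
    qed
  qed
  with max show ?thesis
    unfolding R_def by blast
qed

end
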